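(* Let $\widetilde G=(I,P;E)$ be a pinned $d$-isostatic graph and $p$ a generic configuration. Suppose that for every inner vertex $v\in I$, the pinned framework obtained from $(\widetilde G,p)$ by deleting $v$ and all edges incident to it has a finite motion in which every remaining inner vertex moves. Then $\widetilde G$ is $d$-Assur.
   Context: Fix $d\ge1$. A pinned graph $\widetilde G=(I,P;E)$ has disjoint finite sets $I$ (inner) and $P$ (pinned) of vertices and a finite multiset $E$ of edges, each an unordered pair of distinct vertices with at least one endpoint in $I$. A configuration $p$ assigns $p_v\in\mathbb R^d$ to each vertex. A finite motion of a pinned framework is a continuous path $p(t)$ of configurations with $p(0)=p$, pinned vertices fixed, and all edge lengths $\|p_u(t)-p_v(t)\|$ constant; an inner vertex moves if its position is not constant along the path. The pinned rigidity matrix $R(\widetilde G,p)$ is the $|E|\times d|I|$ matrix with one row per edge and $d$ columns per inner vertex: the row of $\{i,j\}$, $i,j\in I$, has $p_i-p_j$ in the columns of $i$, $p_j-p_i$ in the columns of $j$, zeros elsewhere; the row of $\{i,k\}$, $i\in I$, $k\in P$, has $p_i-p_k$ in the columns of $i$, zeros elsewhere. $p$ is generic if it lies in the open dense set where this matrix attains maximum rank. $\widetilde G$ is pinned $d$-isostatic if for some (equivalently every generic) $p$, $R(\widetilde G,p)$ is square and invertible; it is $d$-Assur if additionally it has no pinned $d$-isostatic subgraph $(I',P';E')$ with $\emptyset\ne I'\subsetneq I$. *)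

theory Defs
  imports "HOL-Analysis.Analysis" "Jordan_Normal_Form.DL_Rank"
begin

record 'v pinned_graph =
  inner_verts :: "'v set"
  pinned_verts :: "'v set"
  edges :: "'v set multiset"

definition pinned_graph :: "'v pinned_graph \<Rightarrow> bool" where
  "pinned_graph G \<longleftrightarrow>
     finite (inner_verts G) \<and> finite (pinned_verts G) \<and> inner_verts G \<inter> pinned_verts G = {} \<and>
     (\<forall>e \<in># edges G. \<exists>i \<in> inner_verts G. \<exists>j \<in> inner_verts G \<union> pinned_verts G.
        i \<noteq> j \<and> e = {i, j})"

definition pinned_subgraph :: "'v pinned_graph \<Rightarrow> 'v pinned_graph \<Rightarrow> bool" where
  "pinned_subgraph H G \<longleftrightarrow> pinned_graph H \<and> inner_verts H \<subseteq> inner_verts G \<and>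
     pinned_verts H \<subseteq> pinned_verts G \<and> edges H \<subseteq># edges G"

definition delete_vertex :: "'v \<Rightarrow> 'v pinned_graph \<Rightarrow> 'v pinned_graph" where
  "delete_vertex v G =
     \<lparr>inner_verts = inner_verts G - {v}, pinned_verts = pinned_verts G,
      edges = filter_mset (\<lambda>e. v \<notin> e) (edges G)\<rparr>"

text \<open>A configuration in \<open>\<real>\<^sup>d\<close> is a function \<open>'v \<Rightarrow> real ^ 'd\<close> with \<open>d = CARD('d)\<close>;
  its values outside the vertex set of the graph at hand are irrelevant.\<close>

text \<open>Matrix entries in the row of edge \<open>e\<close> and the columns of vertex \<open>i\<close>;
  for \<open>e = {i, j}\<close> with \<open>i \<noteq> j\<close>, the other endpoint \<open>j\<close> is \<open>the_elem (e - {i})\<close>.\<close>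

definition rigidity_row :: "('v \<Rightarrow> real ^ 'd) \<Rightarrow> 'v set \<Rightarrow> 'v \<Rightarrow> real ^ 'd" where
  "rigidity_row p e i = (if i \<in> e then p i - p (the_elem (e - {i})) else 0)"

text \<open>Rows are indexed by the edges with multiplicity, columns by the pairs (inner vertex,
  coordinate), both listed in an arbitrary fixed order. Rank and invertibility do not depend
  on these orders.\<close>

definition edge_list :: "'v pinned_graph \<Rightarrow> 'v set list" where
  "edge_list G = (SOME es. mset es = edges G)"

definition column_list :: "'v pinned_graph \<Rightarrow> ('v \<times> 'd) list" where
  "column_list G = (SOME cs. distinct cs \<and> set cs = inner_verts G \<times> UNIV)"

definition rigidity_matrix :: "'v pinned_graph \<Rightarrow> ('v \<Rightarrow> real ^ 'd) \<Rightarrow> real Matrix.mat" where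
  "rigidity_matrix G p =
     (let es = edge_list G; cs = (column_list G :: ('v \<times> 'd) list) in
      Matrix.mat (length es) (length cs)
        (\<lambda>(r, c). vec_nth (rigidity_row p (es ! r) (fst (cs ! c))) (snd (cs ! c))))"

definition generic_config :: "'v pinned_graph \<Rightarrow> ('v \<Rightarrow> real ^ 'd) \<Rightarrow> bool" where
  "generic_config G p \<longleftrightarrow>
     (\<forall>q :: 'v \<Rightarrow> real ^ 'd.
        vec_space.rank (size (edges G)) (rigidity_matrix G q)
          \<le> vec_space.rank (size (edges G)) (rigidity_matrix G p))"

text \<open>\<^const>\<open>invertible_mat\<close> includes squareness.\<close>

definition pinned_isostatic :: "'d::finite itself \<Rightarrow> 'v pinned_graph \<Rightarrow> bool" where
  "pinned_isostatic _ G \<longleftrightarrow>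
     (\<exists>p :: 'v \<Rightarrow> real ^ 'd. invertible_mat (rigidity_matrix G p))"

definition assur :: "'d::finite itself \<Rightarrow> 'v pinned_graph \<Rightarrow> bool" where
  "assur d G \<longleftrightarrow> pinned_isostatic d G \<and>
     \<not> (\<exists>H. pinned_subgraph H G \<and> inner_verts H \<noteq> {} \<and> inner_verts H \<subset> inner_verts G \<and>
          pinned_isostatic d H)"

text \<open>\<open>m t v\<close> is the position of vertex \<open>v\<close> at time \<open>t \<in> [0, 1]\<close>; \<^const>\<open>path\<close> is
  continuity on \<open>[0, 1]\<close>.\<close>

definition finite_motion ::
  "'v pinned_graph \<Rightarrow> ('v \<Rightarrow> real ^ 'd) \<Rightarrow> (real \<Rightarrow> 'v \<Rightarrow> real ^ 'd) \<Rightarrow> bool" where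
  "finite_motion G p m \<longleftrightarrow>
     (\<forall>v \<in> inner_verts G \<union> pinned_verts G. path (\<lambda>t. m t v) \<and> m 0 v = p v) \<and>
     (\<forall>v \<in> pinned_verts G. \<forall>t \<in> {0..1}. m t v = p v) \<and>
     (\<forall>u v. {u, v} \<in># edges G \<longrightarrow> (\<forall>t \<in> {0..1}. norm (m t u - m t v) = norm (p u - p v)))"

definition moves :: "(real \<Rightarrow> 'v \<Rightarrow> real ^ 'd) \<Rightarrow> 'v \<Rightarrow> bool" where
  "moves m v \<longleftrightarrow> \<not> (\<lambda>t. m t v) constant_on {0..1}"

end

theory Submission
  imports Defs
begin

text \<open>If \<open>H\<close> were a pinned isostatic subgraph on a nonempty proper subset \<open>I'\<close> of the inner vertices,
  then the rows of its edges vanish outside the columns of \<open>I'\<close>, so independence of the rows of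
  the invertible matrix \<open>R(G,p)\<close> makes \<open>R(H,p)\<close> invertible too. For a displacement \<open>x\<close> preserving
  all edge lengths, \<open>2 R(H,p) x\<close> is quadratic in \<open>x\<close>; hence nonzero such \<open>x\<close> have norm bounded away
  from \<open>0\<close>, and by continuity every finite motion of \<open>(H,p)\<close> is constant. Deleting an inner vertex
  outside \<open>I'\<close> leaves \<open>H\<close> intact, so the vertices of \<open>I'\<close> cannot move.\<close>

section \<open>Square matrices\<close>

text \<open>The transpose is singular together with \<open>A\<close>, so it kills a nonzero vector.
  The coefficients form a plain function \<open>w\<close> on row indices, which makes a dependence
  easy to carry to a matrix of another size.\<close>

lemma det_eq_0_iff_left_kernel:
  fixes A :: "'a::field Matrix.mat"
  assumes A: "A \<in> carrier_mat n n"
  shows "Determinant.det A = 0 \<longleftrightarrow>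
    (\<exists>w. (\<exists>r<n. w r \<noteq> 0) \<and> (\<forall>c<n. (\<Sum>r<n. w r * A $$ (r, c)) = 0))"
proof -
  have prod: "vec_index (A\<^sup>T *\<^sub>v v) c = (\<Sum>r<n. vec_index v r * A $$ (r, c))"
    if "v \<in> carrier_vec n" "c < n" for v c
    using that A by (auto simp: scalar_prod_def atLeast0LessThan mult.commute intro!: sum.cong)
  have "Determinant.det A = 0 \<longleftrightarrow> (\<exists>v. v \<in> carrier_vec n \<and> v \<noteq> 0\<^sub>v n \<and> A\<^sup>T *\<^sub>v v = 0\<^sub>v n)"
    using det_0_iff_vec_prod_zero_field[of "A\<^sup>T" n] A by (simp add: det_transpose)
  also have "\<dots> \<longleftrightarrow> (\<exists>w. (\<exists>r<n. w r \<noteq> 0) \<and> (\<forall>c<n. (\<Sum>r<n. w r * A $$ (r, c)) = 0))"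
    (is "?L \<longleftrightarrow> ?R")
  proof
    assume ?L
    then obtain v where v: "v \<in> carrier_vec n" "v \<noteq> 0\<^sub>v n" "A\<^sup>T *\<^sub>v v = 0\<^sub>v n" by blast
    from v(1,2) have "\<exists>r<n. vec_index v r \<noteq> 0" by auto
    moreover have "\<forall>c<n. (\<Sum>r<n. vec_index v r * A $$ (r, c)) = 0"
      using prod[OF v(1)] v(3) by simp
    ultimately show ?R by blast
  next
    assume ?R
    then obtain w where w: "\<exists>r<n. w r \<noteq> 0" "\<forall>c<n. (\<Sum>r<n. w r * A $$ (r, c)) = 0" by blast
    let ?v = "Matrix.vec n w"
    have "?v \<noteq> 0\<^sub>v n" using w(1) by (metis index_vec index_zero_vec(1))
    moreover have "A\<^sup>T *\<^sub>v ?v = 0\<^sub>v n"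
      using A w(2) by (intro eq_vecI) (auto simp: prod simp del: index_mult_mat_vec)
    ultimately show ?L by (intro exI[of _ ?v]) auto
  qed
  finally show ?thesis .
qed

lemma invertible_mat_det_nonzero:
  fixes A :: "'a::field Matrix.mat"
  assumes "invertible_mat A"
  shows "Determinant.det A \<noteq> 0"
proof -
  obtain B where sq: "square_mat A" and AB: "A * B = 1\<^sub>m (dim_row A)" and BA: "B * A = 1\<^sub>m (dim_row B)"
    using assms by (auto simp: invertible_mat_def inverts_mat_def)
  \<comment> \<open>Invertibility does not prescribe the shape of \<open>B\<close>; comparing the
    column counts in the two product identities forces \<open>B\<close> to be square of the size of
    \<open>A\<close>.\<close>
  have "dim_col B = dim_row A" using arg_cong[OF AB, of dim_col] by simp
  moreover have "dim_col A = dim_row B" using arg_cong[OF BA, of dim_col] by simp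
  ultimately have "A \<in> carrier_mat (dim_row A) (dim_row A)" "B \<in> carrier_mat (dim_row A) (dim_row A)"
    using sq by auto
  then have "Determinant.det A * Determinant.det B = 1"
    using AB det_mult[of A "dim_row A" B] by (metis det_one)
  then show ?thesis by auto
qed

text \<open>Applying the inverse recovers x from A x, so the l1 norm of x is controlled by that of A
  x. This makes injectivity quantitative, as needed to compare a linear term with a quadratic
  one.\<close>

lemma det_nonzero_imp_bounded_below:
  fixes A :: "real Matrix.mat"
  assumes A: "A \<in> carrier_mat n n" and d: "Determinant.det A \<noteq> 0"
  obtains K where "K > 0" "\<And>x. (\<Sum>c<n. \<bar>x c\<bar>) \<le> K * (\<Sum>r<n. \<bar>\<Sum>c<n. A $$ (r, c) * x c\<bar>)"
proof -
  obtain B where B: "B \<in> carrier_mat n n" "B * A = 1\<^sub>m n"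
    using det_non_zero_imp_unit[OF A d, of "()"] by (auto simp: Units_def ring_mat_def)
  \<comment> \<open>The sum of all absolute entries of \<open>B\<close> dominates each column sum.
    The final constant \<open>M + 1\<close> is positive even for n = 0, where \<open>M\<close>
    vanishes.\<close>
  define M where "M = (\<Sum>i<n. \<Sum>r<n. \<bar>B $$ (i, r)\<bar>)"
  have M: "M \<ge> 0" unfolding M_def by (intro sum_nonneg) auto
  have "(\<Sum>c<n. \<bar>x c\<bar>) \<le> (M + 1) * (\<Sum>r<n. \<bar>\<Sum>c<n. A $$ (r, c) * x c\<bar>)" for x
  proof -
    define y where "y r = (\<Sum>c<n. A $$ (r, c) * x c)" for r
    have inv: "x i = (\<Sum>r<n. B $$ (i, r) * y r)" if i: "i < n" for i
    proof -
      have "(\<Sum>r<n. B $$ (i, r) * y r) = (\<Sum>c<n. (\<Sum>r<n. B $$ (i, r) * A $$ (r, c)) * x c)"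
        unfolding y_def sum_distrib_left sum_distrib_right
        by (subst sum.swap) (simp add: mult.assoc)
      also have "\<dots> = (\<Sum>c<n. (1\<^sub>m n :: real Matrix.mat) $$ (i, c) * x c)"
      proof (intro sum.cong refl)
        fix c assume c: "c \<in> {..<n}"
        have "(1\<^sub>m n :: real Matrix.mat) $$ (i, c) = (B * A) $$ (i, c)" using B by simp
        also have "\<dots> = (\<Sum>r<n. B $$ (i, r) * A $$ (r, c))"
          using A B(1) i c by (auto simp: scalar_prod_def atLeast0LessThan)
        finally show "(\<Sum>r<n. B $$ (i, r) * A $$ (r, c)) * x c = (1\<^sub>m n :: real Matrix.mat) $$ (i, c) * x c"
          by simp
      qed
      also have "\<dots> = (\<Sum>c<n. if c = i then x c else 0)"
        using i by (intro sum.cong) auto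
      finally show ?thesis using i by simp
    qed
    have "(\<Sum>i<n. \<bar>x i\<bar>) \<le> (\<Sum>i<n. \<Sum>r<n. \<bar>B $$ (i, r)\<bar> * \<bar>y r\<bar>)"
    proof (rule sum_mono)
      fix i assume "i \<in> {..<n}"
      then have "\<bar>x i\<bar> = \<bar>\<Sum>r<n. B $$ (i, r) * y r\<bar>" using inv by simp
      also have "\<dots> \<le> (\<Sum>r<n. \<bar>B $$ (i, r)\<bar> * \<bar>y r\<bar>)"
        by (rule order_trans[OF sum_abs]) (simp add: abs_mult)
      finally show "\<bar>x i\<bar> \<le> (\<Sum>r<n. \<bar>B $$ (i, r)\<bar> * \<bar>y r\<bar>)" .
    qed
    also have "\<dots> = (\<Sum>r<n. (\<Sum>i<n. \<bar>B $$ (i, r)\<bar>) * \<bar>y r\<bar>)"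
      unfolding sum_distrib_right by (rule sum.swap)
    also have "\<dots> \<le> (\<Sum>r<n. (M + 1) * \<bar>y r\<bar>)"
    proof (intro sum_mono mult_right_mono)
      fix r assume "r \<in> {..<n}"
      then have "(\<Sum>i<n. \<bar>B $$ (i, r)\<bar>) \<le> (\<Sum>i<n. \<Sum>r<n. \<bar>B $$ (i, r)\<bar>)"
        by (intro sum_mono member_le_sum) auto
      then show "(\<Sum>i<n. \<bar>B $$ (i, r)\<bar>) \<le> M + 1" by (simp add: M_def)
    qed simp
    finally show ?thesis by (simp add: y_def sum_distrib_left)
  qed
  then show thesis using that[of "M + 1"] M by simp
qed

text \<open>Parallel edges are equal as sets, so rows must be matched by position, not by value.
  Completing \<open>ys\<close> to a rearrangement of \<open>xs\<close> and restricting the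
  permutation to the first positions gives the injection.\<close>

lemma obtain_sublist_embedding:
  assumes "mset ys \<subseteq># mset xs"
  obtains f where "inj_on f {..<length ys}"
    "\<And>i. i < length ys \<Longrightarrow> f i < length xs \<and> ys ! i = xs ! f i"
proof -
  obtain zs where "mset (ys @ zs) = mset xs"
    using assms by (metis ex_mset mset_append subset_mset.add_diff_inverse)
  then obtain f where f: "f permutes {..<length xs}" "permute_list f xs = ys @ zs"
    using mset_eq_permutation by blast
  have len: "length ys + length zs = length xs"
    using arg_cong[OF f(2), of length] by simp
  show thesis
  proof (rule that[of f])
    show "inj_on f {..<length ys}" using f(1) by (metis permutes_inj inj_on_subset subset_UNIV)
    fix i assume i: "i < length ys"
    then have "f i < length xs" using permutes_in_image[OF f(1), of i] len by simp
    moreover have "ys ! i = xs ! f i"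
      using permute_list_nth[OF f(1), of i] i len f(2) by (simp add: nth_append)
    ultimately show "f i < length xs \<and> ys ! i = xs ! f i" ..
  qed
qed

section \<open>Rigidity matrices\<close>

lemma mset_edge_list [simp]: "mset (edge_list G) = edges G"
  unfolding edge_list_def by (rule someI_ex[OF ex_mset])

lemma length_edge_list [simp]: "length (edge_list G) = size (edges G)"
  by (metis mset_edge_list size_mset)

lemma edge_list_nth_mem: "r < size (edges G) \<Longrightarrow> edge_list G ! r \<in># edges G"
  by (metis length_edge_list mset_edge_list nth_mem_mset)

lemma column_list:
  assumes "finite (inner_verts G)"
  shows "distinct (column_list G :: ('v \<times> 'd::finite) list)"
    and "set (column_list G :: ('v \<times> 'd) list) = inner_verts G \<times> UNIV"
proof -
  have "\<exists>cs :: ('v \<times> 'd) list. distinct cs \<and> set cs = inner_verts G \<times> UNIV"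
    using finite_distinct_list[of "inner_verts G \<times> (UNIV :: 'd set)"] assms by auto
  from someI_ex[OF this] show "distinct (column_list G :: ('v \<times> 'd) list)"
    and "set (column_list G :: ('v \<times> 'd) list) = inner_verts G \<times> UNIV"
    unfolding column_list_def by auto
qed

lemma length_column_list:
  assumes "finite (inner_verts G)"
  shows "length (column_list G :: ('v \<times> 'd::finite) list) = card (inner_verts G) * CARD('d)"
  using column_list[OF assms, where 'd = 'd] by (metis distinct_card card_cartesian_product)

text \<open>Removes the arbitrary column order, so that matrix-vector products become sums over
  vertices and coordinates.\<close>

lemma sum_column_list:
  fixes f :: "'v \<times> 'd::finite \<Rightarrow> 'a::comm_monoid_add"
  assumes "finite (inner_verts G)"
  shows "(\<Sum>c<length (column_list G :: ('v \<times> 'd) list). f (column_list G ! c)) =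
    (\<Sum>v\<in>inner_verts G. \<Sum>k\<in>UNIV. f (v, k))"
proof -
  let ?cs = "column_list G :: ('v \<times> 'd) list"
  have "bij_betw ((!) ?cs) {..<length ?cs} (inner_verts G \<times> UNIV)"
    using bij_betw_nth[of ?cs] column_list[OF assms, where 'd = 'd] by blast
  from sum.reindex_bij_betw[OF this, of f] show ?thesis
    by (simp add: sum.cartesian_product)
qed

lemma rigidity_matrix_carrier:
  fixes p :: "'v \<Rightarrow> real ^ 'd::finite"
  assumes "finite (inner_verts G)"
  shows "rigidity_matrix G p \<in> carrier_mat (size (edges G)) (card (inner_verts G) * CARD('d))"
  by (simp add: rigidity_matrix_def Let_def length_column_list[OF assms])

lemma rigidity_matrix_index:
  fixes p :: "'v \<Rightarrow> real ^ 'd::finite"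
  assumes "r < size (edges G)" "c < length (column_list G :: ('v \<times> 'd) list)"
  shows "rigidity_matrix G p $$ (r, c) =
    vec_nth (rigidity_row p (edge_list G ! r) (fst ((column_list G :: ('v \<times> 'd) list) ! c)))
      (snd ((column_list G :: ('v \<times> 'd) list) ! c))"
  using assms by (simp add: rigidity_matrix_def Let_def)

section \<open>Edge counts and nonsingularity of isostatic graphs\<close>

lemma pinned_isostatic_size:
  assumes "finite (inner_verts G)" "pinned_isostatic TYPE('d::finite) G"
  shows "size (edges G) = card (inner_verts G) * CARD('d)"
proof -
  obtain p :: "'a \<Rightarrow> real ^ 'd" where "invertible_mat (rigidity_matrix G p)"
    using assms(2) by (auto simp: pinned_isostatic_def)
  then show ?thesis
    using rigidity_matrix_carrier[OF assms(1), of p] by (auto simp: invertible_mat_def)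
qed

text \<open>The witness \<open>q\<close> of isostaticity has full rank, and a generic
  \<open>p\<close> attains at least the rank of \<open>q\<close>.\<close>

lemma generic_isostatic_det_nonzero:
  fixes p :: "'v \<Rightarrow> real ^ 'd::finite"
  assumes fin: "finite (inner_verts G)" and iso: "pinned_isostatic TYPE('d) G"
    and gen: "generic_config G p"
  shows "Determinant.det (rigidity_matrix G p) \<noteq> 0"
proof -
  obtain q :: "'v \<Rightarrow> real ^ 'd" where q: "invertible_mat (rigidity_matrix G q)"
    using iso by (auto simp: pinned_isostatic_def)
  have carrier: "rigidity_matrix G q' \<in> carrier_mat (size (edges G)) (size (edges G))"
    for q' :: "'v \<Rightarrow> real ^ 'd"
    using rigidity_matrix_carrier[OF fin] pinned_isostatic_size[OF fin iso] by simp
  have "vec_space.rank (size (edges G)) (rigidity_matrix G q) = size (edges G)"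
    using vec_space.det_rank_iff[OF carrier] invertible_mat_det_nonzero[OF q] by blast
  moreover have "vec_space.rank (size (edges G)) (rigidity_matrix G q)
      \<le> vec_space.rank (size (edges G)) (rigidity_matrix G p)"
    using gen by (simp add: generic_config_def)
  ultimately show ?thesis
    using vec_space.det_zero_low_rank[OF carrier, of p] by linarith
qed

lemma pinned_graph_edgeE:
  assumes "pinned_graph G" "e \<in># edges G"
  obtains i j where "i \<in> inner_verts G" "j \<in> inner_verts G \<union> pinned_verts G" "i \<noteq> j" "e = {i, j}"
  using assms unfolding pinned_graph_def by blast

text \<open>A dependence among the rows of \<open>H\<close>, extended by zero, is a dependence among
  the rows of \<open>G\<close> at the same \<open>p\<close>. Isostaticity of \<open>H\<close> enters
  only as an edge count, so its witnessing configuration need not be related to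
  \<open>p\<close>.\<close>

lemma subgraph_det_nonzero:
  fixes p :: "'v \<Rightarrow> real ^ 'd::finite"
  assumes G: "pinned_graph G" and sub: "pinned_subgraph H G"
    and sizeG: "size (edges G) = card (inner_verts G) * CARD('d)"
    and sizeH: "size (edges H) = card (inner_verts H) * CARD('d)"
    and det: "Determinant.det (rigidity_matrix G p) \<noteq> 0"
  shows "Determinant.det (rigidity_matrix H p) \<noteq> 0"
proof
  assume det0: "Determinant.det (rigidity_matrix H p) = 0"
  have H: "pinned_graph H" and inner: "inner_verts H \<subseteq> inner_verts G"
    and pinned: "pinned_verts H \<subseteq> pinned_verts G" and edges: "edges H \<subseteq># edges G"
    using sub by (auto simp: pinned_subgraph_def)
  have fin: "finite (inner_verts G)" "finite (inner_verts H)"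
    and disj: "inner_verts G \<inter> pinned_verts G = {}"
    using G H by (auto simp: pinned_graph_def)
  let ?m = "size (edges G)" and ?n = "size (edges H)"
  let ?cG = "column_list G :: ('v \<times> 'd) list" and ?cH = "column_list H :: ('v \<times> 'd) list"
  have lenG: "length ?cG = ?m" and lenH: "length ?cH = ?n"
    using sizeG sizeH fin by (simp_all add: length_column_list)
  have RG: "rigidity_matrix G p \<in> carrier_mat ?m ?m" and RH: "rigidity_matrix H p \<in> carrier_mat ?n ?n"
    using rigidity_matrix_carrier[of G p] rigidity_matrix_carrier[of H p] fin sizeG sizeH by simp_all
  obtain w where w: "\<exists>r<?n. w r \<noteq> 0"
    and ker: "\<And>c. c < ?n \<Longrightarrow> (\<Sum>r<?n. w r * rigidity_matrix H p $$ (r, c)) = 0"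
    using det0 det_eq_0_iff_left_kernel[OF RH] by blast
  obtain f where f: "inj_on f {..<?n}"
    "\<And>r. r < ?n \<Longrightarrow> f r < ?m \<and> edge_list H ! r = edge_list G ! f r"
    using obtain_sublist_embedding[of "edge_list H" "edge_list G"] edges by auto
  \<comment> \<open>The dependence survives in all columns of \<open>G\<close>: in those of inner
    vertices of \<open>H\<close> it is given, and in the others every entry is zero.\<close>
  have row0: "(\<Sum>r<?n. w r * vec_nth (rigidity_row p (edge_list H ! r) v) k) = 0"
    if v: "v \<in> inner_verts G" for v k
  proof (cases "v \<in> inner_verts H")
    case True
    then have "(v, k) \<in> set ?cH" using column_list(2)[OF fin(2), where 'd = 'd] by simp
    then obtain c where "c < ?n" "?cH ! c = (v, k)" using lenH by (metis in_set_conv_nth)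
    then show ?thesis using ker[of c] lenH by (simp add: rigidity_matrix_index)
  next
    case False
    \<comment> \<open>An inner vertex of \<open>G\<close> is not pinned in \<open>G\<close>, hence
      not in \<open>H\<close>; outside \<open>inner_verts H\<close> it is therefore no vertex of
      \<open>H\<close> at all.\<close>
    have "v \<notin> edge_list H ! r" if "r < ?n" for r
    proof (rule pinned_graph_edgeE[OF H edge_list_nth_mem[OF that]])
      fix i j assume "i \<in> inner_verts H" "j \<in> inner_verts H \<union> pinned_verts H" "edge_list H ! r = {i, j}"
      then show ?thesis using False v pinned disj by auto
    qed
    then show ?thesis by (simp add: rigidity_row_def)
  qed
  \<comment> \<open>The coefficients are moved along the injection \<open>f\<close>, with zero on
    the rows of \<open>G\<close> outside its image.\<close>
  define w' where "w' s = (if s \<in> f ` {..<?n} then w (inv_into {..<?n} f s) else 0)" for s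
  have w'f: "w' (f r) = w r" if "r < ?n" for r
    using that f(1) by (simp add: w'_def)
  have "(\<Sum>s<?m. w' s * rigidity_matrix G p $$ (s, c)) = 0" if c: "c < ?m" for c
  proof -
    obtain v k where vk: "?cG ! c = (v, k)" by force
    then have v: "v \<in> inner_verts G"
      using column_list(2)[OF fin(1), where 'd = 'd] nth_mem[of c ?cG] c lenG by auto
    have "(\<Sum>s<?m. w' s * rigidity_matrix G p $$ (s, c)) =
        (\<Sum>s\<in>f ` {..<?n}. w' s * rigidity_matrix G p $$ (s, c))"
      using f(2) by (intro sum.mono_neutral_right) (auto simp: w'_def)
    also have "\<dots> = (\<Sum>r<?n. w r * vec_nth (rigidity_row p (edge_list H ! r) v) k)"
      unfolding sum.reindex[OF f(1)]
      using f(2) c lenG vk by (auto simp: w'f rigidity_matrix_index intro!: sum.cong)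
    finally show ?thesis using row0[OF v] by simp
  qed
  moreover have "\<exists>s<?m. w' s \<noteq> 0"
  proof -
    obtain r where r: "r < ?n" "w r \<noteq> 0" using w by blast
    with w'f[OF r(1)] f(2)[OF r(1)] show ?thesis by (intro exI[of _ "f r"]) simp
  qed
  ultimately show False using det det_eq_0_iff_left_kernel[OF RG] by blast
qed

text \<open>The blocks at i and j are opposite vectors. A pinned j has no columns, but its
  displacement is zero, so adding j to the index set changes nothing and both kinds of edge are
  treated alike.\<close>

lemma rigidity_row_sum:
  fixes p x :: "'v \<Rightarrow> real ^ 'd::finite"
  assumes fin: "finite I" and "i \<in> I" "i \<noteq> j" and x: "j \<notin> I \<Longrightarrow> x j = 0"
  shows "(\<Sum>v\<in>I. inner (rigidity_row p {i, j} v) (x v)) = inner (p i - p j) (x i - x j)"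
proof -
  have row: "rigidity_row p {i, j} i = p i - p j" "rigidity_row p {i, j} j = p j - p i"
    using \<open>i \<noteq> j\<close> by (simp_all add: rigidity_row_def insert_Diff_if)
  have "(\<Sum>v\<in>I. inner (rigidity_row p {i, j} v) (x v)) =
      (\<Sum>v\<in>insert j I. inner (rigidity_row p {i, j} v) (x v))"
    using fin x by (cases "j \<in> I") (auto simp: insert_absorb)
  also have "\<dots> = (\<Sum>v\<in>{i, j}. inner (rigidity_row p {i, j} v) (x v))"
    using fin \<open>i \<in> I\<close> by (intro sum.mono_neutral_right) (auto simp: rigidity_row_def)
  also have "\<dots> = inner (p i - p j) (x i - x j)"
    using \<open>i \<noteq> j\<close> by (simp add: row inner_diff_left inner_diff_right)
  finally show ?thesis .
qed

section \<open>Finite motions\<close>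

text \<open>Translates the l1 bound from coordinates to vertices: the Euclidean norm is at most the
  l1 norm, and each row acts as a sum of inner products.\<close>

lemma rigidity_matrix_bounded_below:
  fixes p :: "'v \<Rightarrow> real ^ 'd::finite"
  assumes fin: "finite (inner_verts G)"
    and size: "size (edges G) = card (inner_verts G) * CARD('d)"
    and det: "Determinant.det (rigidity_matrix G p) \<noteq> 0"
  obtains K where "K > 0"
    "\<And>x. (\<Sum>v\<in>inner_verts G. norm (x v)) \<le>
      K * (\<Sum>r<size (edges G). \<bar>\<Sum>v\<in>inner_verts G. inner (rigidity_row p (edge_list G ! r) v) (x v)\<bar>)"
proof -
  let ?n = "size (edges G)" and ?cs = "column_list G :: ('v \<times> 'd) list"
  have len: "length ?cs = ?n" using size fin by (simp add: length_column_list)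
  have "rigidity_matrix G p \<in> carrier_mat ?n ?n"
    using rigidity_matrix_carrier[OF fin, of p] size by simp
  from det_nonzero_imp_bounded_below[OF this det] obtain K where K: "K > 0"
    "\<And>x. (\<Sum>c<?n. \<bar>x c\<bar>) \<le> K * (\<Sum>r<?n. \<bar>\<Sum>c<?n. rigidity_matrix G p $$ (r, c) * x c\<bar>)"
    by blast
  show thesis
  proof (rule that[OF K(1)])
    fix x :: "'v \<Rightarrow> real ^ 'd"
    let ?x = "\<lambda>c. vec_nth (x (fst (?cs ! c))) (snd (?cs ! c))"
    have "(\<Sum>v\<in>inner_verts G. norm (x v)) \<le> (\<Sum>v\<in>inner_verts G. \<Sum>k\<in>UNIV. \<bar>vec_nth (x v) k\<bar>)"
      by (intro sum_mono norm_le_l1_cart)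
    also have "\<dots> = (\<Sum>c<?n. \<bar>?x c\<bar>)"
      using sum_column_list[OF fin, of "\<lambda>(v, k). \<bar>vec_nth (x v) k\<bar>"] len
      by (simp add: case_prod_unfold)
    also have "\<dots> \<le> K * (\<Sum>r<?n. \<bar>\<Sum>c<?n. rigidity_matrix G p $$ (r, c) * ?x c\<bar>)"
      by (rule K(2))
    also have "(\<Sum>r<?n. \<bar>\<Sum>c<?n. rigidity_matrix G p $$ (r, c) * ?x c\<bar>) =
        (\<Sum>r<?n. \<bar>\<Sum>v\<in>inner_verts G. inner (rigidity_row p (edge_list G ! r) v) (x v)\<bar>)"
    proof (intro sum.cong refl arg_cong[of _ _ abs])
      fix r assume "r \<in> {..<?n}"
      then have "(\<Sum>c<?n. rigidity_matrix G p $$ (r, c) * ?x c) =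
          (\<Sum>c<?n. vec_nth (rigidity_row p (edge_list G ! r) (fst (?cs ! c))) (snd (?cs ! c)) * ?x c)"
        using len by (simp add: rigidity_matrix_index)
      also have "\<dots> = (\<Sum>v\<in>inner_verts G. inner (rigidity_row p (edge_list G ! r) v) (x v))"
        using sum_column_list[OF fin,
            of "\<lambda>(v, k). vec_nth (rigidity_row p (edge_list G ! r) v) k * vec_nth (x v) k"] len
        by (simp add: case_prod_unfold inner_vec_def)
      finally show "(\<Sum>c<?n. rigidity_matrix G p $$ (r, c) * ?x c) =
        (\<Sum>v\<in>inner_verts G. inner (rigidity_row p (edge_list G ! r) v) (x v))" .
    qed
    finally show "(\<Sum>v\<in>inner_verts G. norm (x v)) \<le>
      K * (\<Sum>r<?n. \<bar>\<Sum>v\<in>inner_verts G. inner (rigidity_row p (edge_list G ! r) v) (x v)\<bar>)" .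
  qed
qed

text \<open>The inequality excludes all sufficiently small positive values, and a continuous
  function starting at 0 cannot jump over this gap.\<close>

lemma continuous_quadratic_gap_eq_0:
  fixes N :: "real \<Rightarrow> real"
  assumes cont: "continuous_on {0..1} N" and "N 0 = 0" and nonneg: "\<And>t. N t \<ge> 0"
    and gap: "\<And>t. t \<in> {0..1} \<Longrightarrow> N t \<le> C * (N t)\<^sup>2" and t: "t \<in> {0..1}"
  shows "N t = 0"
proof (rule ccontr)
  assume "N t \<noteq> 0"
  then have pos: "N t > 0" using nonneg[of t] by simp
  \<comment> \<open>The bound \<open>N t\<close> lets the intermediate value theorem reach
    \<open>y\<close>; the other bound gives \<bar>C\<bar> y < 1, and its +1 avoids division by zero
    when C = 0.\<close>
  define y where "y = min (N t) (1 / (2 * (\<bar>C\<bar> + 1)))"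
  have y: "0 < y" "y \<le> N t" "y * (2 * (\<bar>C\<bar> + 1)) \<le> 1"
    using pos by (auto simp: y_def min_def field_simps)
  have "continuous_on {0..t} N" using cont t by (auto intro: continuous_on_subset)
  then obtain s where s: "0 \<le> s" "s \<le> t" "N s = y"
    using IVT'[of N 0 y t] y t \<open>N 0 = 0\<close> by auto
  then have "y \<le> C * y\<^sup>2" using gap[of s] t by auto
  then have "1 \<le> C * y" using y(1) by (simp add: power2_eq_square)
  also have "\<dots> \<le> \<bar>C\<bar> * y" using y(1) by (intro mult_right_mono) auto
  also have "\<dots> < 1" using y(1,3) by (simp add: algebra_simps)
  finally show False by simp
qed

text \<open>The path is only assumed continuous, so no velocity is available. Instead the whole
  displacement from \<open>p\<close> is put into the matrix, and length preservation is expanded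
  exactly.\<close>

lemma finite_motion_fixed:
  fixes p :: "'v \<Rightarrow> real ^ 'd::finite"
  assumes G: "pinned_graph G"
    and size: "size (edges G) = card (inner_verts G) * CARD('d)"
    and det: "Determinant.det (rigidity_matrix G p) \<noteq> 0"
    and motion: "finite_motion G p m"
    and v: "v \<in> inner_verts G" and t: "t \<in> {0..1}"
  shows "m t v = p v"
proof -
  let ?I = "inner_verts G" and ?n = "size (edges G)"
  have fin: "finite ?I" and disj: "?I \<inter> pinned_verts G = {}"
    using G by (auto simp: pinned_graph_def)
  obtain K where K: "K > 0" "\<And>x. (\<Sum>v\<in>?I. norm (x v)) \<le>
      K * (\<Sum>r<?n. \<bar>\<Sum>v\<in>?I. inner (rigidity_row p (edge_list G ! r) v) (x v)\<bar>)"
    using rigidity_matrix_bounded_below[OF fin size det] by blast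
  define x where "x t v = m t v - p v" for t v
  define N where "N t = (\<Sum>v\<in>?I. norm (x t v))" for t
  \<comment> \<open>Each of the \<open>?n\<close> rows contributes at most half of the square of
    \<open>N t\<close>, and \<open>K\<close> is the constant of the lower bound.\<close>
  have "N t \<le> K * (real ?n / 2) * (N t)\<^sup>2" if t: "t \<in> {0..1}" for t
  proof -
    have "\<bar>\<Sum>v\<in>?I. inner (rigidity_row p (edge_list G ! r) v) (x t v)\<bar> \<le> (N t)\<^sup>2 / 2"
      if r: "r < ?n" for r
    proof -
      obtain i j where ij: "i \<in> ?I" "j \<in> ?I \<union> pinned_verts G" "i \<noteq> j" "edge_list G ! r = {i, j}"
        using pinned_graph_edgeE[OF G edge_list_nth_mem[OF r]] by blast
      have xj: "x t j = 0" if "j \<notin> ?I"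
        using that ij(2) motion t by (auto simp: x_def finite_motion_def)
      have "norm (m t i - m t j) = norm (p i - p j)"
        using motion t edge_list_nth_mem[OF r] ij(4) by (auto simp: finite_motion_def)
      moreover have "m t i - m t j = (p i - p j) + (x t i - x t j)" by (simp add: x_def)
      \<comment> \<open>Expanding the squared length of the moved edge cancels the original squared
        length and leaves the linear term equal to minus the quadratic one.\<close>
      ultimately have "2 * inner (p i - p j) (x t i - x t j) = - (norm (x t i - x t j))\<^sup>2"
        using dot_norm[of "p i - p j" "x t i - x t j"] by simp
      moreover have "norm (x t i - x t j) \<le> N t"
      proof -
        have "norm (x t i - x t j) \<le> norm (x t i) + norm (x t j)" by (rule norm_triangle_ineq4)
        also have "\<dots> = (\<Sum>v\<in>{i, j}. norm (x t v))" using ij(3) by simp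
        \<comment> \<open>The intersection drops a pinned endpoint, whose displacement is
          zero.\<close>
        also have "\<dots> = (\<Sum>v\<in>{i, j} \<inter> ?I. norm (x t v))"
          using ij(1) xj by (intro sum.mono_neutral_right) auto
        also have "\<dots> \<le> N t" unfolding N_def by (intro sum_mono2 fin) auto
        finally show ?thesis .
      qed
      then have "(norm (x t i - x t j))\<^sup>2 \<le> (N t)\<^sup>2" by (simp add: power_mono)
      ultimately have "\<bar>inner (p i - p j) (x t i - x t j)\<bar> \<le> (N t)\<^sup>2 / 2"
        using zero_le_power2[of "norm (x t i - x t j)"] by linarith
      then show ?thesis
        using rigidity_row_sum[OF fin ij(1,3), of "x t" p] xj ij(4) by simp
    qed
    then have "(\<Sum>r<?n. \<bar>\<Sum>v\<in>?I. inner (rigidity_row p (edge_list G ! r) v) (x t v)\<bar>)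
        \<le> (\<Sum>r<?n. (N t)\<^sup>2 / 2)"
      by (intro sum_mono) auto
    then have "K * (\<Sum>r<?n. \<bar>\<Sum>v\<in>?I. inner (rigidity_row p (edge_list G ! r) v) (x t v)\<bar>)
        \<le> K * (\<Sum>r<?n. (N t)\<^sup>2 / 2)"
      using K(1) by (intro mult_left_mono) auto
    then show ?thesis using K(2)[of "x t"] by (simp add: N_def)
  qed
  moreover have "continuous_on {0..1} N"
    unfolding N_def x_def using motion
    by (intro continuous_intros) (auto simp: finite_motion_def path_def)
  moreover have "N 0 = 0" using motion by (simp add: N_def x_def finite_motion_def)
  moreover have "N s \<ge> 0" for s by (simp add: N_def sum_nonneg)
  ultimately have "N t = 0" using continuous_quadratic_gap_eq_0 t by blast
  then have "norm (x t v) = 0" using fin v by (simp add: N_def sum_nonneg_eq_0_iff)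
  then show ?thesis by (simp add: x_def)
qed

section \<open>Passage to subgraphs and the contradiction\<close>

lemma finite_motion_subgraph:
  assumes "pinned_subgraph H G" "finite_motion G p m"
  shows "finite_motion H p m"
  using assms unfolding finite_motion_def pinned_subgraph_def by (blast dest: mset_subset_eqD)

text \<open>Edges of \<open>H\<close> join vertices of \<open>H\<close>, so none contains v;
  filtering leaves \<open>edges H\<close> unchanged and is monotone on multisets, so multiplicities
  are respected.\<close>

lemma pinned_subgraph_delete_vertex:
  assumes sub: "pinned_subgraph H G" and v: "v \<notin> inner_verts H" "v \<notin> pinned_verts H"
  shows "pinned_subgraph H (delete_vertex v G)"
proof -
  have "pinned_graph H" using sub by (simp add: pinned_subgraph_def)
  then have "\<And>e. e \<in># edges H \<Longrightarrow> v \<notin> e" using v by (blast elim: pinned_graph_edgeE)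
  then have "filter_mset (\<lambda>e. v \<notin> e) (edges H) = edges H"
    by (simp add: filter_mset_eq_conv)
  then have "edges H \<subseteq># filter_mset (\<lambda>e. v \<notin> e) (edges G)"
    using sub multiset_filter_mono[of "edges H" "edges G"] by (metis pinned_subgraph_def)
  then show ?thesis using sub v by (auto simp: pinned_subgraph_def delete_vertex_def)
qed

theorem theorem4p5:
  fixes G :: "'v pinned_graph" and p :: "'v \<Rightarrow> real ^ 'd::finite"
  assumes "pinned_graph G"
    and "pinned_isostatic TYPE('d) G"
    and "generic_config G p"
    and "\<And>v. v \<in> inner_verts G \<Longrightarrow>
           \<exists>m. finite_motion (delete_vertex v G) p m \<and>
               (\<forall>w \<in> inner_verts (delete_vertex v G). moves m w)"
  shows "assur TYPE('d) G"
  unfolding assur_def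
proof (intro conjI notI)
  show "pinned_isostatic TYPE('d) G" by fact
  assume "\<exists>H. pinned_subgraph H G \<and> inner_verts H \<noteq> {} \<and> inner_verts H \<subset> inner_verts G \<and>
    pinned_isostatic TYPE('d) H"
  then obtain H where sub: "pinned_subgraph H G" and ne: "inner_verts H \<noteq> {}"
    and proper: "inner_verts H \<subset> inner_verts G" and iso: "pinned_isostatic TYPE('d) H" by blast
  have H: "pinned_graph H" and pinned: "pinned_verts H \<subseteq> pinned_verts G"
    using sub by (auto simp: pinned_subgraph_def)
  have fin: "finite (inner_verts G)" "finite (inner_verts H)"
    and disj: "inner_verts G \<inter> pinned_verts G = {}"
    using assms(1) H by (auto simp: pinned_graph_def)
  have size: "size (edges H) = card (inner_verts H) * CARD('d)"
    using pinned_isostatic_size[OF fin(2) iso] .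
  have det: "Determinant.det (rigidity_matrix H p) \<noteq> 0"
    using subgraph_det_nonzero[OF assms(1) sub pinned_isostatic_size[OF fin(1) assms(2)] size]
      generic_isostatic_det_nonzero[OF fin(1) assms(2,3)] by blast
  obtain v where v: "v \<in> inner_verts G" "v \<notin> inner_verts H" using proper by blast
  obtain m where m: "finite_motion (delete_vertex v G) p m"
    "\<And>w. w \<in> inner_verts (delete_vertex v G) \<Longrightarrow> moves m w"
    using assms(4)[OF v(1)] by blast
  have subv: "pinned_subgraph H (delete_vertex v G)"
    using pinned_subgraph_delete_vertex[OF sub] v pinned disj by blast
  \<comment> \<open>Any inner vertex of \<open>H\<close> remains after deleting v: by assumption it
    moves, yet the restriction of the motion to the rigid \<open>H\<close> fixes it.\<close>
  obtain w where w: "w \<in> inner_verts H" using ne by blast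
  have "moves m w" using m(2) w subv by (auto simp: pinned_subgraph_def)
  moreover have "m t w = p w" if "t \<in> {0..1}" for t
    using finite_motion_fixed[OF H size det finite_motion_subgraph[OF subv m(1)] w that] .
  ultimately show False by (auto simp: moves_def constant_on_def)
qed

end
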